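(* Let $j\in\{1,\ldots,J-1\}$ be fixed, let $I\subset\mathbb{R}$ be an arbitrary subset, and let $n_j$, $n_j'$ be given such that $n_j(\omega)\ne0$ for every $\omega\in I$ and such that there exists a value $\omega_0\in I\setminus\{0\}$ with $\operatorname{Im}(n_j'(\omega_0))>0$. Assume that $(n_{j+1},n_{j+1}',z_{j+1},z_{j+1}')$ and $(\tilde n_{j+1},\tilde n_{j+1}',\tilde z_{j+1},\tilde z_{j+1}')$ satisfy $$ m_j[n_{j+1},n_{j+1}',z_{j+1},z_{j+1}'](\omega,\delta)=m_j[\tilde n_{j+1},\tilde n_{j+1}',\tilde z_{j+1},\tilde z_{j+1}'](\omega,\delta) $$ for all $\omega\in I$ and $\delta\in\mathbb{R}$. Then $$ n_{j+1}(\omega)=\tilde n_{j+1}(\omega),\quad n_{j+1}'(\omega)=\tilde n_{j+1}'(\omega),\quad z_{j+1}=\tilde z_{j+1},\quad\text{and}\quad z_{j+1}'=\tilde z_{j+1}' $$ for all $\omega\in I$.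
   Context: Let $c>0$ denote the speed of light, let $J$ be the number of layers, and let $\mathbb{H}=\{z\in\mathbb{C}\mid\operatorname{Im}z>0\}$. Primes do not denote derivatives; primed quantities are independent parameters (rates of change under compression). The functions $n_j:\mathbb{R}\to\mathbb{H}$ (refractive index of the $j$-th layer) and $n_j':\mathbb{R}\to\mathbb{C}$ are known. The unknowns are the refractive index $n_{j+1}:\mathbb{R}\to\mathbb{H}$ of layer $j+1$, a function $n_{j+1}':\mathbb{R}\to\mathbb{C}$, and real numbers $z_{j+1},z_{j+1}'$. For $\delta\in\mathbb{R}$ and $i\in\{j,j+1\}$ set $\bar n_i(\omega,\delta)=n_i(\omega)+\delta n_i'(\omega)$ and $\bar z_{j+1}(\delta)=z_{j+1}+\delta z_{j+1}'$, and define the data $$ m_j[n_{j+1},n_{j+1}',z_{j+1},z_{j+1}'](\omega,\delta)=\frac{\bar n_{j+1}(\omega,\delta)-\bar n_j(\omega,\delta)}{\bar n_{j+1}(\omega,\delta)+\bar n_j(\omega,\delta)}\,e^{-2i\frac{\omega}{c}\bar n_j(\omega,\delta)\bar z_{j+1}(\delta)}. $$ The quantities with a tilde define $m_j[\tilde n_{j+1},\tilde n_{j+1}',\tilde z_{j+1},\tilde z_{j+1}']$ by the same formula, with the same $n_j,n_j'$.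
   Formalization: The formal theorem also assumes that n_{j+1}(ω0) ≠ n_j(ω0) or n_{j+1}'(ω0) ≠ n_j'(ω0) at some ω0 in I∖{0} with Im n_j'(ω0) > 0; if layers j and j+1 coincide, all data vanish and z_{j+1}, z_{j+1}' are not determined. *)

theory Defs
  imports Complex_Main
begin

(* Primed variables are independent parameters (rates of change under compression),
   not derivatives. *)

definition nbar :: "(real \<Rightarrow> complex) \<Rightarrow> (real \<Rightarrow> complex) \<Rightarrow> real \<Rightarrow> real \<Rightarrow> complex" where
  "nbar n n' \<omega> \<delta> = n \<omega> + of_real \<delta> * n' \<omega>"

definition zbar :: "real \<Rightarrow> real \<Rightarrow> real \<Rightarrow> real" where
  "zbar z z' \<delta> = z + \<delta> * z'"

(* The data m_j[N, N', z, z'](\<omega>, \<delta>), where p and p' are the known n_j and n_j',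
   and N, N', z, z' are the quantities with index j + 1.

   Pitfall 1: where the denominator vanishes, HOL division gives the value 0. Since N and p
   take values in the open upper half plane, the denominator is nonzero at \<delta> = 0, so for
   each \<omega> this concerns at most one value of \<delta>.

   Pitfall 2: if N \<omega> = p \<omega> and N' \<omega> = p' \<omega>, then the data at \<omega> vanish for every \<delta> and
   carry no information on z and z'. A uniqueness statement for z and z' has to exclude
   this at the frequency from which they are determined. *)
definition layer_data ::
  "real \<Rightarrow> (real \<Rightarrow> complex) \<Rightarrow> (real \<Rightarrow> complex) \<Rightarrow>
   (real \<Rightarrow> complex) \<Rightarrow> (real \<Rightarrow> complex) \<Rightarrow> real \<Rightarrow> real \<Rightarrow> real \<Rightarrow> real \<Rightarrow> complex" where
  "layer_data c p p' N N' z z' \<omega> \<delta> =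
     (nbar N N' \<omega> \<delta> - nbar p p' \<omega> \<delta>) / (nbar N N' \<omega> \<delta> + nbar p p' \<omega> \<delta>) *
     exp (- 2 * \<i> * of_real (\<omega> / c) * nbar p p' \<omega> \<delta> * of_real (zbar z z' \<delta>))"

end

theory Submission
  imports Defs
begin

text \<open>
  For fixed \<open>\<omega>\<close> the data are a quotient of two complex affine functions of \<open>\<delta>\<close> times an
  exponential, and for large \<open>\<delta>\<close> the two factors live on different scales. The logarithm of the
  modulus of a nonzero affine function is \<open>o(\<delta>)\<close> (\<open>ln_norm_affine_sublinear\<close>), whereas the
  logarithm of the modulus of the exponential is the real polynomial
  \<open>2 (\<omega> / c) Im (p \<omega> + \<delta> p' \<omega>) (z + \<delta> z')\<close> of degree at most two.

  At \<open>\<omega>0\<close>, subtracting the logarithms for the two sets of unknowns therefore gives a real polynomial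
  in \<open>\<delta>\<close> that is \<open>o(\<delta>)\<close>, so its linear and quadratic coefficients vanish. Since
  \<open>Im (p' \<omega>0) > 0\<close> and \<open>\<omega>0 \<noteq> 0\<close>, the quadratic coefficient yields equality of the \<open>z'\<close> and then
  the linear one equality of the \<open>z\<close> (\<open>layer_data_determines_depth\<close>). This requires that the data at
  \<open>\<omega>0\<close> do not vanish identically.

  Once the depths agree, the exponentials cancel at every \<open>\<omega>\<close>, and the map
  \<open>a \<mapsto> (a - p) / (a + p)\<close> is injective for \<open>p \<noteq> 0\<close>. Evaluating at \<open>\<delta> = 0\<close> and at one
  further \<open>\<delta>\<close> determines both coefficients of the affine function \<open>N \<omega> + \<delta> N' \<omega>\<close>
  (\<open>layer_data_determines_index\<close>).
\<close>

lemma affine_eventually_nonzero: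
  fixes u v :: complex
  assumes "u \<noteq> 0 \<or> v \<noteq> 0"
  shows "eventually (\<lambda>\<delta>. u + of_real \<delta> * v \<noteq> 0) at_top"
proof (cases "v = 0")
  case True
  then show ?thesis using assms by simp
next
  case False
  have "u + of_real \<delta> * v \<noteq> 0" if "\<delta> > cmod u / cmod v" for \<delta> :: real
  proof
    assume "u + of_real \<delta> * v = 0"
    then have "u = - (of_real \<delta> * v)"
      by (simp add: eq_neg_iff_add_eq_0)
    then have "cmod u = \<bar>\<delta>\<bar> * cmod v"
      by (simp add: norm_mult)
    then have "\<bar>\<delta>\<bar> = cmod u / cmod v"
      using False by simp
    then show False
      using that by simp
  qed
  then show ?thesis
    by (rule eventually_mono[OF eventually_gt_at_top])
qed

text \<open>Factoring out \<open>\<delta>\<close> from a nonconstant affine function leaves a factor with a nonzero limit, so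
  the logarithm is \<open>ln \<delta> + O(1)\<close>.\<close>

lemma ln_norm_affine_sublinear:
  fixes u v :: complex
  assumes "u \<noteq> 0 \<or> v \<noteq> 0"
  shows "((\<lambda>\<delta>. ln (cmod (u + of_real \<delta> * v)) / \<delta>) \<longlongrightarrow> 0) at_top"
proof (cases "v = 0")
  case True
  then show ?thesis
    by (simp add: tendsto_divide_0[OF tendsto_const filterlim_at_top_imp_at_infinity] filterlim_ident)
next
  case False
  have inv: "((\<lambda>\<delta>::real. inverse \<delta>) \<longlongrightarrow> 0) at_top"
    by (rule tendsto_inverse_0_at_top) (rule filterlim_ident)
  have "((\<lambda>\<delta>. cmod (of_real (inverse \<delta>) * u + v)) \<longlongrightarrow> cmod (of_real 0 * u + v)) at_top"
    by (intro tendsto_intros inv)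
  then have "((\<lambda>\<delta>. ln (cmod (of_real (inverse \<delta>) * u + v))) \<longlongrightarrow> ln (cmod v)) at_top"
    using False by (intro tendsto_ln) auto
  then have "((\<lambda>\<delta>. ln \<delta> / \<delta> + ln (cmod (of_real (inverse \<delta>) * u + v)) * inverse \<delta>)
      \<longlongrightarrow> 0 + ln (cmod v) * 0) at_top"
    by (intro tendsto_add tendsto_mult inv ln_x_over_x_tendsto_0)
  then have lim: "((\<lambda>\<delta>. ln \<delta> / \<delta> + ln (cmod (of_real (inverse \<delta>) * u + v)) * inverse \<delta>)
      \<longlongrightarrow> 0) at_top"
    by simp
  have "eventually (\<lambda>\<delta>. ln \<delta> / \<delta> + ln (cmod (of_real (inverse \<delta>) * u + v)) * inverse \<delta>
      = ln (cmod (u + of_real \<delta> * v)) / \<delta>) at_top"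
    using eventually_gt_at_top[of 0] affine_eventually_nonzero[OF assms]
  proof eventually_elim
    case (elim \<delta>)
    have factor: "u + of_real \<delta> * v = of_real \<delta> * (of_real (inverse \<delta>) * u + v)"
      using elim(1) by (simp add: field_simps)
    then have "of_real (inverse \<delta>) * u + v \<noteq> 0"
      using elim(2) by auto
    then have "ln (cmod (u + of_real \<delta> * v)) = ln \<delta> + ln (cmod (of_real (inverse \<delta>) * u + v))"
      unfolding factor norm_mult using elim(1) by (subst ln_mult) auto
    then show ?case
      by (simp add: add_divide_distrib divide_inverse distrib_right)
  qed
  with lim show ?thesis
    by (rule Lim_transform_eventually)
qed

lemma sublinear_quadratic_coefficients_zero:
  fixes q0 q1 q2 :: real
  assumes "((\<lambda>\<delta>. (q0 + q1 * \<delta> + q2 * \<delta>\<^sup>2) / \<delta>) \<longlongrightarrow> 0) at_top"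
  shows "q1 = 0" "q2 = 0"
proof -
  have inv: "((\<lambda>\<delta>::real. inverse \<delta>) \<longlongrightarrow> 0) at_top"
    by (rule tendsto_inverse_0_at_top) (rule filterlim_ident)
  have "((\<lambda>\<delta>. (q0 + q1 * \<delta> + q2 * \<delta>\<^sup>2) / \<delta> * inverse \<delta>
      - q0 * inverse \<delta> * inverse \<delta> - q1 * inverse \<delta>) \<longlongrightarrow> 0 * 0 - q0 * 0 * 0 - q1 * 0) at_top"
    by (intro tendsto_intros assms inv)
  moreover have "eventually (\<lambda>\<delta>. (q0 + q1 * \<delta> + q2 * \<delta>\<^sup>2) / \<delta> * inverse \<delta>
      - q0 * inverse \<delta> * inverse \<delta> - q1 * inverse \<delta> = q2) at_top"
    using eventually_gt_at_top[of 0]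
    by eventually_elim (simp add: field_simps power2_eq_square)
  ultimately have "((\<lambda>\<delta>::real. q2) \<longlongrightarrow> 0) at_top"
    using Lim_transform_eventually by fastforce
  then show "q2 = 0"
    by (simp add: tendsto_const_iff)
  have "((\<lambda>\<delta>. (q0 + q1 * \<delta> + q2 * \<delta>\<^sup>2) / \<delta> - q0 * inverse \<delta>) \<longlongrightarrow> 0 - q0 * 0) at_top"
    by (intro tendsto_intros assms inv)
  moreover have "eventually (\<lambda>\<delta>. (q0 + q1 * \<delta> + q2 * \<delta>\<^sup>2) / \<delta> - q0 * inverse \<delta> = q1) at_top"
    using eventually_gt_at_top[of 0]
    by eventually_elim (simp add: field_simps \<open>q2 = 0\<close>)
  ultimately have "((\<lambda>\<delta>::real. q1) \<longlongrightarrow> 0) at_top"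
    using Lim_transform_eventually by fastforce
  then show "q1 = 0"
    by (simp add: tendsto_const_iff)
qed

lemma nbar_diff_affine:
  "nbar N N' \<omega> \<delta> - nbar p p' \<omega> \<delta> = (N \<omega> - p \<omega>) + of_real \<delta> * (N' \<omega> - p' \<omega>)"
  by (simp add: nbar_def algebra_simps)

lemma nbar_sum_affine:
  "nbar N N' \<omega> \<delta> + nbar p p' \<omega> \<delta> = (N \<omega> + p \<omega>) + of_real \<delta> * (N' \<omega> + p' \<omega>)"
  by (simp add: nbar_def algebra_simps)

lemma layer_data_eventually_nonzero:
  assumes "N \<omega> + p \<omega> \<noteq> 0" and "N \<omega> \<noteq> p \<omega> \<or> N' \<omega> \<noteq> p' \<omega>"
  shows "eventually (\<lambda>\<delta>. layer_data c p p' N N' z z' \<omega> \<delta> \<noteq> 0) at_top"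
proof -
  have "eventually (\<lambda>\<delta>. (N \<omega> - p \<omega>) + of_real \<delta> * (N' \<omega> - p' \<omega>) \<noteq> 0) at_top"
    using assms(2) by (intro affine_eventually_nonzero) auto
  moreover have "eventually (\<lambda>\<delta>. (N \<omega> + p \<omega>) + of_real \<delta> * (N' \<omega> + p' \<omega>) \<noteq> 0) at_top"
    using assms(1) by (intro affine_eventually_nonzero) auto
  ultimately show ?thesis
    by eventually_elim (simp add: layer_data_def nbar_diff_affine nbar_sum_affine)
qed

text \<open>The reflection coefficient is a quotient of affine functions and hence contributes only
  \<open>o(\<delta>)\<close> to the logarithm of the modulus; the growth rate is read off from the exponential.\<close>

lemma ln_norm_layer_data_asymptotics:
  assumes "N \<omega> + p \<omega> \<noteq> 0" and "N \<omega> \<noteq> p \<omega> \<or> N' \<omega> \<noteq> p' \<omega>"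
  shows "((\<lambda>\<delta>. (ln (cmod (layer_data c p p' N N' z z' \<omega> \<delta>))
      - 2 * (\<omega> / c) * Im (nbar p p' \<omega> \<delta>) * zbar z z' \<delta>) / \<delta>) \<longlongrightarrow> 0) at_top"
proof -
  let ?A = "\<lambda>\<delta>. (N \<omega> - p \<omega>) + of_real \<delta> * (N' \<omega> - p' \<omega>)"
  let ?B = "\<lambda>\<delta>. (N \<omega> + p \<omega>) + of_real \<delta> * (N' \<omega> + p' \<omega>)"
  have nzA: "N \<omega> - p \<omega> \<noteq> 0 \<or> N' \<omega> - p' \<omega> \<noteq> 0"
    using assms(2) by auto
  have nzB: "N \<omega> + p \<omega> \<noteq> 0 \<or> N' \<omega> + p' \<omega> \<noteq> 0"
    using assms(1) by auto
  have "((\<lambda>\<delta>. ln (cmod (?A \<delta>)) / \<delta> - ln (cmod (?B \<delta>)) / \<delta>) \<longlongrightarrow> 0 - 0) at_top"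
    by (intro tendsto_diff ln_norm_affine_sublinear nzA nzB)
  then have lim: "((\<lambda>\<delta>. ln (cmod (?A \<delta>)) / \<delta> - ln (cmod (?B \<delta>)) / \<delta>) \<longlongrightarrow> 0) at_top"
    by simp
  have "eventually (\<lambda>\<delta>. ln (cmod (?A \<delta>)) / \<delta> - ln (cmod (?B \<delta>)) / \<delta>
      = (ln (cmod (layer_data c p p' N N' z z' \<omega> \<delta>))
        - 2 * (\<omega> / c) * Im (nbar p p' \<omega> \<delta>) * zbar z z' \<delta>) / \<delta>) at_top"
    using affine_eventually_nonzero[OF nzA] affine_eventually_nonzero[OF nzB]
  proof eventually_elim
    case (elim \<delta>)
    have re: "Re (- 2 * \<i> * of_real (\<omega> / c) * nbar p p' \<omega> \<delta> * of_real (zbar z z' \<delta>))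
        = 2 * (\<omega> / c) * Im (nbar p p' \<omega> \<delta>) * zbar z z' \<delta>"
      by simp
    have "cmod (layer_data c p p' N N' z z' \<omega> \<delta>) = cmod (?A \<delta>) / cmod (?B \<delta>)
        * exp (2 * (\<omega> / c) * Im (nbar p p' \<omega> \<delta>) * zbar z z' \<delta>)"
      unfolding layer_data_def nbar_diff_affine nbar_sum_affine norm_mult norm_divide
        norm_exp_eq_Re re ..
    moreover have "cmod (?A \<delta>) > 0" "cmod (?B \<delta>) > 0"
      using elim by simp_all
    ultimately have "ln (cmod (layer_data c p p' N N' z z' \<omega> \<delta>)) = ln (cmod (?A \<delta>))
        - ln (cmod (?B \<delta>)) + 2 * (\<omega> / c) * Im (nbar p p' \<omega> \<delta>) * zbar z z' \<delta>"
      by (simp add: ln_mult ln_div)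
    then show ?case
      by (simp add: diff_divide_distrib)
  qed
  with lim show ?thesis
    by (rule Lim_transform_eventually)
qed

lemma layer_data_determines_depth:
  assumes "c \<noteq> 0" and "\<omega> \<noteq> 0" and "Im (p' \<omega>) \<noteq> 0"
    and N: "N \<omega> + p \<omega> \<noteq> 0" and M: "M \<omega> + p \<omega> \<noteq> 0"
    and nontrivial: "N \<omega> \<noteq> p \<omega> \<or> N' \<omega> \<noteq> p' \<omega>"
    and eq: "\<And>\<delta>. layer_data c p p' N N' z z' \<omega> \<delta> = layer_data c p p' M M' y y' \<omega> \<delta>"
  shows "z = y" "z' = y'"
proof -
  \<comment> \<open>Data that vanish for every \<open>\<delta>\<close> cannot match data that are eventually nonzero.\<close>
  have nontrivial': "M \<omega> \<noteq> p \<omega> \<or> M' \<omega> \<noteq> p' \<omega>"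
  proof (rule ccontr)
    assume "\<not> ?thesis"
    then have "layer_data c p p' M M' y y' \<omega> \<delta> = 0" for \<delta>
      by (simp add: layer_data_def nbar_def)
    moreover have "eventually (\<lambda>\<delta>. layer_data c p p' N N' z z' \<omega> \<delta> \<noteq> 0) at_top"
      using N nontrivial by (rule layer_data_eventually_nonzero)
    ultimately show False
      by (simp add: eq)
  qed
  define k where "k = 2 * (\<omega> / c)"
  \<comment> \<open>In the difference of the two asymptotic relations the logarithms of the data cancel.\<close>
  have "((\<lambda>\<delta>. (ln (cmod (layer_data c p p' M M' y y' \<omega> \<delta>))
        - 2 * (\<omega> / c) * Im (nbar p p' \<omega> \<delta>) * zbar y y' \<delta>) / \<delta>
      - (ln (cmod (layer_data c p p' N N' z z' \<omega> \<delta>))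
        - 2 * (\<omega> / c) * Im (nbar p p' \<omega> \<delta>) * zbar z z' \<delta>) / \<delta>) \<longlongrightarrow> 0 - 0) at_top"
    by (intro tendsto_diff ln_norm_layer_data_asymptotics N M nontrivial nontrivial')
  moreover have "(ln (cmod (layer_data c p p' M M' y y' \<omega> \<delta>))
        - 2 * (\<omega> / c) * Im (nbar p p' \<omega> \<delta>) * zbar y y' \<delta>) / \<delta>
      - (ln (cmod (layer_data c p p' N N' z z' \<omega> \<delta>))
        - 2 * (\<omega> / c) * Im (nbar p p' \<omega> \<delta>) * zbar z z' \<delta>) / \<delta>
      = (k * Im (p \<omega>) * (z - y) + k * (Im (p \<omega>) * (z' - y') + Im (p' \<omega>) * (z - y)) * \<delta>
        + k * Im (p' \<omega>) * (z' - y') * \<delta>\<^sup>2) / \<delta>" for \<delta>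
    unfolding eq diff_divide_distrib[symmetric] k_def[symmetric] nbar_def zbar_def
    by (simp add: algebra_simps power2_eq_square)
  ultimately have sublinear:
    "((\<lambda>\<delta>. (k * Im (p \<omega>) * (z - y) + k * (Im (p \<omega>) * (z' - y') + Im (p' \<omega>) * (z - y)) * \<delta>
        + k * Im (p' \<omega>) * (z' - y') * \<delta>\<^sup>2) / \<delta>) \<longlongrightarrow> 0) at_top"
    by simp
  have "k \<noteq> 0"
    using assms(1,2) by (simp add: k_def)
  with sublinear_quadratic_coefficients_zero(2)[OF sublinear] assms(3) show "z' = y'"
    by simp
  with sublinear_quadratic_coefficients_zero(1)[OF sublinear] assms(3) \<open>k \<noteq> 0\<close> show "z = y"
    by simp
qed

lemma reflection_coefficient_inj:
  fixes a b p :: complex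
  assumes "p \<noteq> 0" "a + p \<noteq> 0" "b + p \<noteq> 0" "(a - p) / (a + p) = (b - p) / (b + p)"
  shows "a = b"
proof -
  have "(a - p) * (b + p) = (b - p) * (a + p)"
    using assms by (simp add: frac_eq_eq)
  then have "2 * p * (a - b) = 0"
    by (simp add: algebra_simps)
  then show ?thesis
    using assms(1) by simp
qed

text \<open>A zero of \<open>p \<omega> + \<delta> p' \<omega>\<close> or of one of the denominators would spoil the comparison at that
  \<open>\<delta>\<close>. None of them vanishes at \<open>\<delta> = 0\<close>, so none is identically zero and every sufficiently
  large \<open>\<delta>\<close> can serve as the second evaluation point.\<close>

lemma layer_data_determines_index:
  assumes p: "p \<omega> \<noteq> 0" and N: "N \<omega> + p \<omega> \<noteq> 0" and M: "M \<omega> + p \<omega> \<noteq> 0"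
    and eq: "\<And>\<delta>. layer_data c p p' N N' z z' \<omega> \<delta> = layer_data c p p' M M' z z' \<omega> \<delta>"
  shows "N \<omega> = M \<omega>" "N' \<omega> = M' \<omega>"
proof -
  have nbar_eq: "nbar N N' \<omega> \<delta> = nbar M M' \<omega> \<delta>"
    if "nbar p p' \<omega> \<delta> \<noteq> 0" "nbar N N' \<omega> \<delta> + nbar p p' \<omega> \<delta> \<noteq> 0"
      "nbar M M' \<omega> \<delta> + nbar p p' \<omega> \<delta> \<noteq> 0" for \<delta>
    using eq[of \<delta>] unfolding layer_data_def mult_right_cancel[OF exp_not_eq_zero]
    by (rule reflection_coefficient_inj[OF that])
  from nbar_eq[of 0] show *: "N \<omega> = M \<omega>"
    using p N M by (simp add: nbar_def)
  have "eventually (\<lambda>\<delta>. nbar p p' \<omega> \<delta> \<noteq> 0) at_top"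
    unfolding nbar_def using p by (intro affine_eventually_nonzero) simp
  moreover have "eventually (\<lambda>\<delta>. nbar N N' \<omega> \<delta> + nbar p p' \<omega> \<delta> \<noteq> 0) at_top"
    unfolding nbar_sum_affine using N by (intro affine_eventually_nonzero) simp
  moreover have "eventually (\<lambda>\<delta>. nbar M M' \<omega> \<delta> + nbar p p' \<omega> \<delta> \<noteq> 0) at_top"
    unfolding nbar_sum_affine using M by (intro affine_eventually_nonzero) simp
  ultimately have "eventually (\<lambda>\<delta>. N' \<omega> = M' \<omega>) (at_top :: real filter)"
    using eventually_gt_at_top[of 0]
  proof eventually_elim
    case (elim \<delta>)
    from nbar_eq[OF elim(1-3)] * have "of_real \<delta> * N' \<omega> = of_real \<delta> * M' \<omega>"
      by (simp add: nbar_def)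
    with elim(4) show ?case by simp
  qed
  then show "N' \<omega> = M' \<omega>"
    by simp
qed

theorem lemma5p3:
  fixes c :: real and J j :: nat and I :: "real set"
    and n n' nt nt' :: "nat \<Rightarrow> real \<Rightarrow> complex"
    and z z' zt zt' :: "nat \<Rightarrow> real"
  assumes "c > 0"
    and "j \<in> {1..J - 1}"
    and "\<And>\<omega>. Im (n j \<omega>) > 0"
    and "\<And>\<omega>. Im (n (j + 1) \<omega>) > 0"
    and "\<And>\<omega>. Im (nt (j + 1) \<omega>) > 0"
    and "\<And>\<omega>. \<omega> \<in> I \<Longrightarrow> n j \<omega> \<noteq> 0"
    and "\<exists>\<omega>0 \<in> I - {0}. Im (n' j \<omega>0) > 0 \<and>
           (n (j + 1) \<omega>0 \<noteq> n j \<omega>0 \<or> n' (j + 1) \<omega>0 \<noteq> n' j \<omega>0)"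
    and "\<And>\<omega> \<delta>. \<omega> \<in> I \<Longrightarrow>
           layer_data c (n j) (n' j) (n (j + 1)) (n' (j + 1)) (z (j + 1)) (z' (j + 1)) \<omega> \<delta> =
           layer_data c (n j) (n' j) (nt (j + 1)) (nt' (j + 1)) (zt (j + 1)) (zt' (j + 1)) \<omega> \<delta>"
  shows "(\<forall>\<omega> \<in> I. n (j + 1) \<omega> = nt (j + 1) \<omega> \<and> n' (j + 1) \<omega> = nt' (j + 1) \<omega>) \<and>
         z (j + 1) = zt (j + 1) \<and> z' (j + 1) = zt' (j + 1)"
proof -
  have Im_sum_nonzero: "a + b \<noteq> 0" if "Im a > 0" "Im b > 0" for a b :: complex
  proof
    assume "a + b = 0"
    then have "Im a + Im b = 0"
      by (metis plus_complex.simps(2) zero_complex.simps(2))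
    with that show False by simp
  qed
  have N: "n (j + 1) \<omega> + n j \<omega> \<noteq> 0" and M: "nt (j + 1) \<omega> + n j \<omega> \<noteq> 0" for \<omega>
    by (intro Im_sum_nonzero assms(3-5))+
  obtain \<omega>0 where \<omega>0: "\<omega>0 \<in> I" "\<omega>0 \<noteq> 0" "Im (n' j \<omega>0) > 0"
    "n (j + 1) \<omega>0 \<noteq> n j \<omega>0 \<or> n' (j + 1) \<omega>0 \<noteq> n' j \<omega>0"
    using assms(7) by blast
  have c: "c \<noteq> 0" and p': "Im (n' j \<omega>0) \<noteq> 0"
    using \<open>c > 0\<close> \<omega>0(3) by auto
  note depth = layer_data_determines_depth
    [where p = "n j" and p' = "n' j" and N = "n (j + 1)" and N' = "n' (j + 1)"
      and M = "nt (j + 1)" and M' = "nt' (j + 1)", OF c \<omega>0(2) p' N M \<omega>0(4) assms(8)[OF \<omega>0(1)]]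
  have "n (j + 1) \<omega> = nt (j + 1) \<omega> \<and> n' (j + 1) \<omega> = nt' (j + 1) \<omega>" if "\<omega> \<in> I" for \<omega>
    using layer_data_determines_index[where p = "n j" and p' = "n' j"
        and N = "n (j + 1)" and N' = "n' (j + 1)" and M = "nt (j + 1)" and M' = "nt' (j + 1)", OF assms(6)[OF that] N M
        assms(8)[OF that, folded depth]] by blast
  then show ?thesis
    using depth by blast
qed

end
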